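(* Let $\mathcal{L}=\langle S, Act_\tau,\to\rangle$ be a labelled transition system of processes. Suppose $\phi$ is a formula in $\mathrm{recHML}$ which is may-testable, i.e. there is a test $t$ (a closed term of the test language) such that for every $p\in S$, $p\ \mathbf{may\ satisfy}\ t$ if and only if $p\in[\![\phi]\!]$. Then there exists some $\psi\in\mathrm{mayHML}$ which is logically equivalent to $\phi$, i.e. $[\![\psi]\!]=[\![\phi]\!]$.
   Context: **Labelled transition systems.** An LTS over a countable set $Act$ of external actions is a triple $\langle S,Act_\tau,\to\rangle$ with $S$ a countable set of states (processes), $Act_\tau=Act\cup\{\tau\}$ where $\tau\notin Act$, and $\to\subseteq S\times Act_\tau\times S$; write $s\xrightarrow{\alpha}s'$ for $(s,\alpha,s')\in\to$, and $s\xrightarrow{\alpha}$ if such an $s'$ exists. The letter $a$ ranges over $Act$, $\alpha$ over $Act_\tau$. $s\Uparrow$ (diverges) if there is an infinite path $s\xrightarrow{\tau}s_1\xrightarrow{\tau}\cdots$; otherwise $s\Downarrow$ (converges). Weak transitions: $\stackrel{\tau}{\Rightarrow}$ is the reflexive transitive closure of $\xrightarrow{\tau}$, and $s\stackrel{a}{\Rightarrow}s'$ means $s\stackrel{\tau}{\Rightarrow}s''\xrightarrow{a}s'''\stackrel{\tau}{\Rightarrow}s'$ for some $s'',s'''$; $s\stackrel{\alpha}{\Rightarrow}$ means $s\stackrel{\alpha}{\Rightarrow}s'$ for some $s'$. **The languages recHML and mayHML.** $\mathrm{recHML}$ is the set of closed formulae generated by $\phi ::= \mathtt{tt}\mid\mathtt{ff}\mid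 X\mid \mathrm{Acc}\,A\mid\phi_1\vee\phi_2\mid\phi_1\wedge\phi_2\mid\langle\alpha\rangle\phi\mid[\alpha]\phi\mid\min(X,\phi)\mid\max(X,\phi)$, where $X$ ranges over a countable set $Var$ of variables, $\alpha\in Act_\tau$, $A$ is a finite subset of $Act$, and $\min(X,\cdot)$, $\max(X,\cdot)$ bind $X$. $\mathrm{mayHML}$ is the set of closed formulae generated by the fragment $\phi ::= \mathtt{tt}\mid\mathtt{ff}\mid X\mid\langle\alpha\rangle\phi\mid\phi_1\vee\phi_2\mid \min(X,\phi)$. Given an environment $\rho:Var\to 2^S$: $[\![\mathtt{tt}]\!]\rho=S$; $[\![\mathtt{ff}]\!]\rho=\emptyset$; $[\![X]\!]\rho=\rho(X)$; $[\![\mathrm{Acc}\,A]\!]\rho=\{s : s\Downarrow,\text{ and } s\stackrel{\tau}{\Rightarrow}s'\text{ implies } s'\stackrel{a}{\Rightarrow}\text{ for some }a\in A\}$; $[\![\langle\alpha\rangle\phi]\!]\rho=\{s : s\stackrel{\alpha}{\Rightarrow}s'\text{ for some }s'\in[\![\phi]\!]\rho\}$; $[\![[\alpha]\phi]\!]\rho=\{s : s\Downarrow,\text{ and } s\stackrel{\alpha}{\Rightarrow}s'\text{ implies }s'\in[\![\phi]\!]\rho\}$; $\vee,\wedge$ are union and intersection; $[\![\min(X,\phi)]\!]\rho=\bigcap\{P\subseteq S : [\![\phi]\!]\rho[X\mapsto P]\subseteq P\}$; $[\![\max(X,\phi)]\!]\rho=\bigcup\{P\subseteq S : P\subseteq[\![\phi]\!]\rho[X\mapsto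 P]\}$. For closed $\phi$ the environment is omitted. **Tests.** Let $\omega\notin Act_\tau$. Tests are the closed terms of $t::=0\mid\alpha.t\mid\omega.0\mid X\mid t_1+t_2\mid\mu X.t$ ($\alpha\in Act_\tau$, $\mu X$ binds $X$), with transitions given by the rules: $\alpha.t\xrightarrow{\alpha}t$ for $\alpha\in Act_\tau\cup\{\omega\}$; if $t_i\xrightarrow{\alpha}t'$ for $i=1$ or $i=2$ then $t_1+t_2\xrightarrow{\alpha}t'$; $\mu X.t\xrightarrow{\tau}t\{\mu X.t/X\}$. **Testing.** For a process $p$ and test $t$, the experiment $p\,|\,t$ has only $\tau$-moves: $p|t\to p'|t$ if $p\xrightarrow{\tau}p'$; $p|t\to p|t'$ if $t\xrightarrow{\tau}t'$; $p|t\to p'|t'$ if $p\xrightarrow{a}p'$ and $t\xrightarrow{a}t'$ for some $a\in Act$. A computation of $p|t$ is a maximal (finite or infinite) path $p|t\to p_1|t_1\to\cdots$ (with $p_0=p$, $t_0=t$); it is successful if $t_n\xrightarrow{\omega}$ for some $n\ge0$. $p\ \mathbf{may\ satisfy}\ t$ if there exists a successful computation of $p|t$. *)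

theory Defs
  imports Main "HOL-Library.Countable_Set" "HOL-Library.Extended_Nat"
begin

datatype 'a act = Tau | Vis 'a

definition act_tau :: "'a set \<Rightarrow> 'a act set" where
  "act_tau A = insert Tau (Vis ` A)"

record ('s, 'a) lts =
  states :: "'s set"
  actions :: "'a set"
  trans :: "('s \<times> 'a act \<times> 's) set"

definition is_lts :: "('s, 'a) lts \<Rightarrow> bool" where
  "is_lts L \<longleftrightarrow> countable (states L) \<and> countable (actions L) \<and>
     trans L \<subseteq> states L \<times> act_tau (actions L) \<times> states L"

definition diverges :: "('s, 'a) lts \<Rightarrow> 's \<Rightarrow> bool" where
  "diverges L s \<longleftrightarrow> (\<exists>f :: nat \<Rightarrow> 's. f 0 = s \<and> (\<forall>n. (f n, Tau, f (Suc n)) \<in> trans L))"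

abbreviation converges :: "('s, 'a) lts \<Rightarrow> 's \<Rightarrow> bool" where
  "converges L s \<equiv> \<not> diverges L s"

definition weak_tau :: "('s, 'a) lts \<Rightarrow> ('s \<times> 's) set" where
  "weak_tau L = {(s, s'). (s, Tau, s') \<in> trans L}\<^sup>*"

fun weak :: "('s, 'a) lts \<Rightarrow> 's \<Rightarrow> 'a act \<Rightarrow> 's \<Rightarrow> bool" where
  "weak L s Tau s' \<longleftrightarrow> (s, s') \<in> weak_tau L"
| "weak L s (Vis a) s' \<longleftrightarrow>
     (\<exists>s1 s2. (s, s1) \<in> weak_tau L \<and> (s1, Vis a, s2) \<in> trans L \<and> (s2, s') \<in> weak_tau L)"

datatype 'a fm =
    TT
  | FF
  | FVar nat
  | Acc "'a set"
  | Or "'a fm" "'a fm"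
  | And "'a fm" "'a fm"
  | Dia "'a act" "'a fm"
  | Box "'a act" "'a fm"
  | MinFP nat "'a fm"
  | MaxFP nat "'a fm"

primrec fv :: "'a fm \<Rightarrow> nat set" where
  "fv TT = {}"
| "fv FF = {}"
| "fv (FVar X) = {X}"
| "fv (Acc A) = {}"
| "fv (Or \<phi> \<psi>) = fv \<phi> \<union> fv \<psi>"
| "fv (And \<phi> \<psi>) = fv \<phi> \<union> fv \<psi>"
| "fv (Dia \<alpha> \<phi>) = fv \<phi>"
| "fv (Box \<alpha> \<phi>) = fv \<phi>"
| "fv (MinFP X \<phi>) = fv \<phi> - {X}"
| "fv (MaxFP X \<phi>) = fv \<phi> - {X}"

primrec fm_over :: "'a set \<Rightarrow> 'a fm \<Rightarrow> bool" where
  "fm_over Act TT \<longleftrightarrow> True"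
| "fm_over Act FF \<longleftrightarrow> True"
| "fm_over Act (FVar X) \<longleftrightarrow> True"
| "fm_over Act (Acc A) \<longleftrightarrow> finite A \<and> A \<subseteq> Act"
| "fm_over Act (Or \<phi> \<psi>) \<longleftrightarrow> fm_over Act \<phi> \<and> fm_over Act \<psi>"
| "fm_over Act (And \<phi> \<psi>) \<longleftrightarrow> fm_over Act \<phi> \<and> fm_over Act \<psi>"
| "fm_over Act (Dia \<alpha> \<phi>) \<longleftrightarrow> \<alpha> \<in> act_tau Act \<and> fm_over Act \<phi>"
| "fm_over Act (Box \<alpha> \<phi>) \<longleftrightarrow> \<alpha> \<in> act_tau Act \<and> fm_over Act \<phi>"
| "fm_over Act (MinFP X \<phi>) \<longleftrightarrow> fm_over Act \<phi>"
| "fm_over Act (MaxFP X \<phi>) \<longleftrightarrow> fm_over Act \<phi>"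

primrec may_fragment :: "'a fm \<Rightarrow> bool" where
  "may_fragment TT \<longleftrightarrow> True"
| "may_fragment FF \<longleftrightarrow> True"
| "may_fragment (FVar X) \<longleftrightarrow> True"
| "may_fragment (Acc A) \<longleftrightarrow> False"
| "may_fragment (Or \<phi> \<psi>) \<longleftrightarrow> may_fragment \<phi> \<and> may_fragment \<psi>"
| "may_fragment (And \<phi> \<psi>) \<longleftrightarrow> False"
| "may_fragment (Dia \<alpha> \<phi>) \<longleftrightarrow> may_fragment \<phi>"
| "may_fragment (Box \<alpha> \<phi>) \<longleftrightarrow> False"
| "may_fragment (MinFP X \<phi>) \<longleftrightarrow> may_fragment \<phi>"
| "may_fragment (MaxFP X \<phi>) \<longleftrightarrow> False"

definition recHML :: "'a set \<Rightarrow> 'a fm set" where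
  "recHML Act = {\<phi>. fm_over Act \<phi> \<and> fv \<phi> = {}}"

definition mayHML :: "'a set \<Rightarrow> 'a fm set" where
  "mayHML Act = {\<phi>. fm_over Act \<phi> \<and> may_fragment \<phi> \<and> fv \<phi> = {}}"

primrec sem_env :: "('s, 'a) lts \<Rightarrow> 'a fm \<Rightarrow> (nat \<Rightarrow> 's set) \<Rightarrow> 's set" where
  "sem_env L TT \<rho> = states L"
| "sem_env L FF \<rho> = {}"
| "sem_env L (FVar X) \<rho> = \<rho> X"
| "sem_env L (Acc A) \<rho> =
     {s \<in> states L. converges L s \<and>
        (\<forall>s'. weak L s Tau s' \<longrightarrow> (\<exists>a\<in>A. \<exists>s''. weak L s' (Vis a) s''))}"
| "sem_env L (Or \<phi> \<psi>) \<rho> = sem_env L \<phi> \<rho> \<union> sem_env L \<psi> \<rho>"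
| "sem_env L (And \<phi> \<psi>) \<rho> = sem_env L \<phi> \<rho> \<inter> sem_env L \<psi> \<rho>"
| "sem_env L (Dia \<alpha> \<phi>) \<rho> =
     {s \<in> states L. \<exists>s'. weak L s \<alpha> s' \<and> s' \<in> sem_env L \<phi> \<rho>}"
| "sem_env L (Box \<alpha> \<phi>) \<rho> =
     {s \<in> states L. converges L s \<and> (\<forall>s'. weak L s \<alpha> s' \<longrightarrow> s' \<in> sem_env L \<phi> \<rho>)}"
| "sem_env L (MinFP X \<phi>) \<rho> =
     \<Inter> {P. P \<subseteq> states L \<and> sem_env L \<phi> (\<rho>(X := P)) \<subseteq> P}"
| "sem_env L (MaxFP X \<phi>) \<rho> =
     \<Union> {P. P \<subseteq> states L \<and> P \<subseteq> sem_env L \<phi> (\<rho>(X := P))}"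

lemma sem_env_cong:
  "(\<And>X. X \<in> fv \<phi> \<Longrightarrow> \<rho> X = \<rho>' X) \<Longrightarrow> sem_env L \<phi> \<rho> = sem_env L \<phi> \<rho>'"
proof (induction \<phi> arbitrary: \<rho> \<rho>')
  case (MinFP X \<phi>)
  have "sem_env L \<phi> (\<rho>(X := P)) = sem_env L \<phi> (\<rho>'(X := P))" for P
    by (rule MinFP.IH) (use MinFP.prems in auto)
  then show ?case by simp
next
  case (MaxFP X \<phi>)
  have "sem_env L \<phi> (\<rho>(X := P)) = sem_env L \<phi> (\<rho>'(X := P))" for P
    by (rule MaxFP.IH) (use MaxFP.prems in auto)
  then show ?case by simp
next
  case (Or \<phi> \<psi>)
  have "sem_env L \<phi> \<rho> = sem_env L \<phi> \<rho>'"
    by (rule Or.IH(1)) (use Or.prems in auto)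
  moreover have "sem_env L \<psi> \<rho> = sem_env L \<psi> \<rho>'"
    by (rule Or.IH(2)) (use Or.prems in auto)
  ultimately show ?case by simp
next
  case (And \<phi> \<psi>)
  have "sem_env L \<phi> \<rho> = sem_env L \<phi> \<rho>'"
    by (rule And.IH(1)) (use And.prems in auto)
  moreover have "sem_env L \<psi> \<rho> = sem_env L \<psi> \<rho>'"
    by (rule And.IH(2)) (use And.prems in auto)
  ultimately show ?case by simp
next
  case (Dia \<alpha> \<phi>)
  have "sem_env L \<phi> \<rho> = sem_env L \<phi> \<rho>'"
    by (rule Dia.IH) (use Dia.prems in auto)
  then show ?case by simp
next
  case (Box \<alpha> \<phi>)
  have "sem_env L \<phi> \<rho> = sem_env L \<phi> \<rho>'"
    by (rule Box.IH) (use Box.prems in auto)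
  then show ?case by simp
qed auto

text \<open>The choice of environment is immaterial for closed formulae (lemma \<open>sem_closed\<close>).\<close>

definition sem :: "('s, 'a) lts \<Rightarrow> 'a fm \<Rightarrow> 's set" where
  "sem L \<phi> = sem_env L \<phi> (\<lambda>_. {})"

lemma sem_closed: "fv \<phi> = {} \<Longrightarrow> sem_env L \<phi> \<rho> = sem L \<phi>"
  unfolding sem_def by (rule sem_env_cong) simp

text \<open>\<open>TOmega\<close> is the test \<open>\<omega>.0\<close>, the only form in which \<open>\<omega>\<close> may occur in a test.\<close>

datatype 'a test =
    TNil
  | TPre "'a act" "'a test"
  | TOmega
  | TVar nat
  | TSum "'a test" "'a test"
  | TMu nat "'a test"

primrec test_fv :: "'a test \<Rightarrow> nat set" where
  "test_fv TNil = {}"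
| "test_fv (TPre \<alpha> t) = test_fv t"
| "test_fv TOmega = {}"
| "test_fv (TVar X) = {X}"
| "test_fv (TSum t u) = test_fv t \<union> test_fv u"
| "test_fv (TMu X t) = test_fv t - {X}"

primrec test_over :: "'a set \<Rightarrow> 'a test \<Rightarrow> bool" where
  "test_over Act TNil \<longleftrightarrow> True"
| "test_over Act (TPre \<alpha> t) \<longleftrightarrow> \<alpha> \<in> act_tau Act \<and> test_over Act t"
| "test_over Act TOmega \<longleftrightarrow> True"
| "test_over Act (TVar X) \<longleftrightarrow> True"
| "test_over Act (TSum t u) \<longleftrightarrow> test_over Act t \<and> test_over Act u"
| "test_over Act (TMu X t) \<longleftrightarrow> test_over Act t"

definition tests :: "'a set \<Rightarrow> 'a test set" where
  "tests Act = {t. test_over Act t \<and> test_fv t = {}}"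

text \<open>\<open>tsubst t X u\<close> is \<open>t{u/X}\<close>. It does not rename bound variables: along the transitions of
  a closed test, only closed terms \<open>u\<close> are ever substituted, so no capture can occur.\<close>

primrec tsubst :: "'a test \<Rightarrow> nat \<Rightarrow> 'a test \<Rightarrow> 'a test" where
  "tsubst TNil X u = TNil"
| "tsubst (TPre \<alpha> t) X u = TPre \<alpha> (tsubst t X u)"
| "tsubst TOmega X u = TOmega"
| "tsubst (TVar Y) X u = (if Y = X then u else TVar Y)"
| "tsubst (TSum t1 t2) X u = TSum (tsubst t1 X u) (tsubst t2 X u)"
| "tsubst (TMu Y t) X u = (if Y = X then TMu Y t else TMu Y (tsubst t X u))"

datatype 'a tlabel = Lab "'a act" | Omega

inductive test_step :: "'a test \<Rightarrow> 'a tlabel \<Rightarrow> 'a test \<Rightarrow> bool" where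
  pre: "test_step (TPre \<alpha> t) (Lab \<alpha>) t"
| omega: "test_step TOmega Omega TNil"
| sum1: "test_step t1 l t' \<Longrightarrow> test_step (TSum t1 t2) l t'"
| sum2: "test_step t2 l t' \<Longrightarrow> test_step (TSum t1 t2) l t'"
| mu: "test_step (TMu X t) (Lab Tau) (tsubst t X (TMu X t))"

text \<open>The experiment \<open>p|t\<close> is the pair \<open>(p, t)\<close>.\<close>

inductive exp_step :: "('s, 'a) lts \<Rightarrow> 's \<times> 'a test \<Rightarrow> 's \<times> 'a test \<Rightarrow> bool" for L where
  proc: "(p, Tau, p') \<in> trans L \<Longrightarrow> exp_step L (p, t) (p', t)"
| test: "test_step t (Lab Tau) t' \<Longrightarrow> exp_step L (p, t) (p, t')"
| sync: "(p, Vis a, p') \<in> trans L \<Longrightarrow> test_step t (Lab (Vis a)) t' \<Longrightarrow>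
          exp_step L (p, t) (p', t')"

text \<open>\<open>computation L e N f\<close>: the experiments \<open>f 0, f 1, \<dots>\<close> form a maximal path from \<open>e\<close> with \<open>N\<close>
  steps, infinite iff \<open>N = \<infinity>\<close>. Values \<open>f n\<close> with \<open>n > N\<close> are irrelevant.\<close>

definition computation ::
    "('s, 'a) lts \<Rightarrow> 's \<times> 'a test \<Rightarrow> enat \<Rightarrow> (nat \<Rightarrow> 's \<times> 'a test) \<Rightarrow> bool" where
  "computation L e N f \<longleftrightarrow>
     f 0 = e \<and>
     (\<forall>n. enat n < N \<longrightarrow> exp_step L (f n) (f (Suc n))) \<and>
     (\<forall>n. N = enat n \<longrightarrow> \<not> (\<exists>e'. exp_step L (f n) e'))"

definition successful :: "enat \<Rightarrow> (nat \<Rightarrow> 's \<times> 'a test) \<Rightarrow> bool" where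
  "successful N f \<longleftrightarrow> (\<exists>n. enat n \<le> N \<and> (\<exists>t'. test_step (snd (f n)) Omega t'))"

definition may_satisfy :: "('s, 'a) lts \<Rightarrow> 's \<Rightarrow> 'a test \<Rightarrow> bool" where
  "may_satisfy L p t \<longleftrightarrow> (\<exists>N f. computation L (p, t) N f \<and> successful N f)"

definition may_testable :: "('s, 'a) lts \<Rightarrow> 'a fm \<Rightarrow> bool" where
  "may_testable L \<phi> \<longleftrightarrow>
     (\<exists>t \<in> tests (actions L). \<forall>p \<in> states L. may_satisfy L p t \<longleftrightarrow> p \<in> sem L \<phi>)"

end

(* A test translates directly into a mayHML formula: prefixes become diamonds, sums become
   disjunctions and recursion becomes a least fixed point. Every process in the meaning of the
   formula may satisfy the test, because the processes that may satisfy \<mu>X.t form a pre-fixed point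
   of the meaning of t. Conversely, the meanings of the translated closed tests are closed under
   backward experiment steps, which gives the other inclusion by induction on the length of a
   computation leading to success. *)
theory Submission
  imports Defs
begin

section \<open>May-satisfaction as reachability\<close>

text \<open>Success shows on a finite prefix of a computation, so maximality is dropped; the
  resulting finite paths admit induction.\<close>

definition reaches_success :: "('s, 'a) lts \<Rightarrow> 's \<times> 'a test \<Rightarrow> bool" where
  "reaches_success L e \<longleftrightarrow>
     (\<exists>e' t. (exp_step L)\<^sup>*\<^sup>* e e' \<and> test_step (snd e') Omega t)"

lemma reaches_success_omega: "test_step t Omega t' \<Longrightarrow> reaches_success L (p, t)"
  unfolding reaches_success_def by (metis rtranclp.rtrancl_refl snd_conv)

lemma reaches_success_step: "exp_step L e e' \<Longrightarrow> reaches_success L e' \<Longrightarrow> reaches_success L e"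
  unfolding reaches_success_def by (meson converse_rtranclp_into_rtranclp)

lemma reaches_success_induct [consumes 1, case_names omega step]:
  assumes "reaches_success L e"
    and omega: "\<And>e t. test_step (snd e) Omega t \<Longrightarrow> P e"
    and step: "\<And>e e'. exp_step L e e' \<Longrightarrow> reaches_success L e' \<Longrightarrow> P e' \<Longrightarrow> P e"
  shows "P e"
proof -
  obtain e' t where "(exp_step L)\<^sup>*\<^sup>* e e'" and succ: "test_step (snd e') Omega t"
    using assms(1) unfolding reaches_success_def by blast
  then show ?thesis
  proof (induction rule: converse_rtranclp_induct)
    case base
    then show ?case by (rule omega)
  next
    case (step e1 e2)
    then have "reaches_success L e2" unfolding reaches_success_def by blast
    with step show ?case by (blast intro: assms(3))
  qed
qed

text \<open>Iterate a chosen successor and stop at the first stuck experiment; if there is none, the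
  path is infinite. Either way it is maximal.\<close>

lemma computation_exists: "\<exists>N f. computation L e N f"
proof -
  define next_exp where "next_exp = (\<lambda>e. SOME e'. exp_step L e e')"
  define f where "f = (\<lambda>n. (next_exp ^^ n) e)"
  define stuck where "stuck = (\<lambda>n. \<not> (\<exists>e'. exp_step L (f n) e'))"
  have step: "exp_step L (f n) (f (Suc n))" if "\<not> stuck n" for n
    using that unfolding stuck_def f_def next_exp_def by (auto intro: someI)
  show ?thesis
  proof (cases "\<exists>n. stuck n")
    case True
    define m where "m = (LEAST n. stuck n)"
    have "stuck m" using True unfolding m_def by (metis LeastI)
    moreover have "\<not> stuck n" if "n < m" for n
      using that not_less_Least unfolding m_def by blast
    ultimately have "computation L e (enat m) f"
      unfolding computation_def using step by (auto simp: stuck_def f_def)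
    then show ?thesis by blast
  next
    case False
    then have "computation L e \<infinity> f"
      unfolding computation_def using step by (auto simp: f_def)
    then show ?thesis by blast
  qed
qed

lemma may_satisfy_omega:
  assumes "test_step t Omega t'"
  shows "may_satisfy L p t"
proof -
  obtain N f where comp: "computation L (p, t) N f" using computation_exists by blast
  then have "f 0 = (p, t)" by (simp add: computation_def)
  then have "successful N f" unfolding successful_def using assms
    by (intro exI[of _ 0]) (auto simp: zero_enat_def[symmetric])
  with comp show ?thesis unfolding may_satisfy_def by blast
qed

lemma may_satisfy_step:
  assumes step: "exp_step L (p, t) (p', t')" and "may_satisfy L p' t'"
  shows "may_satisfy L p t"
proof -
  obtain N f where comp: "computation L (p', t') N f" and succ: "successful N f"
    using assms(2) unfolding may_satisfy_def by blast
  \<comment> \<open>\<open>case_nat (p, t) f\<close> puts the new experiment in front of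
    \<open>f\<close>; \<open>eSuc\<close> adds one to a finite length and fixes infinity.\<close>
  have "computation L (p, t) (eSuc N) (case_nat (p, t) f)"
    unfolding computation_def
  proof (intro conjI allI impI)
    fix n assume "enat n < eSuc N"
    then show "exp_step L (case_nat (p, t) f n) (case_nat (p, t) f (Suc n))"
      using comp step unfolding computation_def
      by (cases n) (auto simp: eSuc_enat[symmetric])
  next
    fix n assume N: "eSuc N = enat n"
    then obtain m where "n = Suc m" "N = enat m"
      by (cases N; cases n) (auto simp: eSuc_enat)
    then show "\<not> (\<exists>e'. exp_step L (case_nat (p, t) f n) e')"
      using comp unfolding computation_def by auto
  qed simp
  moreover have "successful (eSuc N) (case_nat (p, t) f)"
  proof -
    obtain n u where "enat n \<le> N" "test_step (snd (f n)) Omega u"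
      using succ unfolding successful_def by blast
    then show ?thesis unfolding successful_def
      by (intro exI[of _ "Suc n"]) (auto simp: eSuc_enat[symmetric])
  qed
  ultimately show ?thesis unfolding may_satisfy_def by blast
qed

lemma may_satisfy_iff_reaches_success: "may_satisfy L p t \<longleftrightarrow> reaches_success L (p, t)"
proof
  assume "may_satisfy L p t"
  then obtain N f n u where comp: "computation L (p, t) N f"
    and n: "enat n \<le> N" "test_step (snd (f n)) Omega u"
    unfolding may_satisfy_def successful_def by blast
  have "(exp_step L)\<^sup>*\<^sup>* (f 0) (f k)" if "k \<le> n" for k
    using that
  proof (induction k)
    case (Suc k)
    then have "enat k < N" using n(1) by (metis Suc_le_lessD enat_ord_simps(2) order_less_le_trans)
    then show ?case using Suc comp unfolding computation_def
      by (meson Suc_leD rtranclp.rtrancl_into_rtrancl)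
  qed simp
  then show "reaches_success L (p, t)"
    using n(2) comp unfolding reaches_success_def computation_def by (metis le_refl)
next
  assume "reaches_success L (p, t)"
  \<comment> \<open>The induction rule ranges over whole experiments, so the goal becomes a
    predicate of the pair.\<close>
  then have "case_prod (may_satisfy L) (p, t)"
    by (induction rule: reaches_success_induct)
      (auto intro: may_satisfy_omega may_satisfy_step)
  then show "may_satisfy L p t" by simp
qed

lemma reaches_success_weak_tau:
  assumes "(p, p') \<in> weak_tau L" "reaches_success L (p', t)"
  shows "reaches_success L (p, t)"
  using assms unfolding weak_tau_def
  by (induction rule: converse_rtrancl_induct) (auto intro: reaches_success_step exp_step.proc)

text \<open>The internal moves in a weak step are made by the process alone, around the single step
  of the prefix.\<close>

lemma reaches_success_prefix:
  assumes "weak L p \<alpha> p'" "reaches_success L (p', t)"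
  shows "reaches_success L (p, TPre \<alpha> t)"
proof (cases \<alpha>)
  case Tau
  then show ?thesis using assms
    by (auto intro: reaches_success_weak_tau reaches_success_step exp_step.test test_step.pre)
next
  case (Vis a)
  then obtain p1 p2 where "(p, p1) \<in> weak_tau L" "(p1, Vis a, p2) \<in> trans L"
    "(p2, p') \<in> weak_tau L"
    using assms(1) by auto
  then show ?thesis unfolding Vis using assms(2)
    by (meson reaches_success_weak_tau reaches_success_step exp_step.sync test_step.pre)
qed

text \<open>Moves of the process alone leave the test in place. The first move of \<open>t\<close>,
  or its \<open>Omega\<close>, is copied by \<open>u\<close>, and from there on both paths
  coincide.\<close>

lemma reaches_success_simulate:
  assumes "reaches_success L (p, t)"
    and sim: "\<And>l t'. test_step t l t' \<Longrightarrow> test_step u l t'"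
  shows "reaches_success L (p, u)"
proof -
  have "snd e = t \<longrightarrow> reaches_success L (fst e, u)" if "reaches_success L e" for e
    using that
  proof (induction rule: reaches_success_induct)
    case (omega e t')
    then show ?case using sim by (auto intro: reaches_success_omega)
  next
    case (step e e')
    show ?case
    proof
      assume t: "snd e = t"
      from step.hyps(1) show "reaches_success L (fst e, u)"
      proof cases
        case proc
        then show ?thesis using step.IH t
          by (auto intro: reaches_success_step exp_step.proc)
      next
        case test
        then show ?thesis using step.hyps(2) t
          by (auto intro: reaches_success_step exp_step.test sim)
      next
        case sync
        then show ?thesis using step.hyps(2) t
          by (auto intro: reaches_success_step exp_step.sync sim)
      qed
    qed
  qed
  with assms(1) show ?thesis by fastforce
qed

section \<open>Fixed points in the semantics\<close>

lemma weak_tau_states: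
  assumes "is_lts L" "(s, s') \<in> weak_tau L" "s' \<in> states L"
  shows "s \<in> states L"
  using assms(2,3,1) unfolding weak_tau_def
  by (induction rule: converse_rtrancl_induct) (auto simp: is_lts_def)

lemma weak_tau_weak:
  assumes "(s, s') \<in> weak_tau L" "weak L s' \<alpha> s''"
  shows "weak L s \<alpha> s''"
  using assms unfolding weak_tau_def
  by (cases \<alpha>) (auto simp: weak_tau_def intro: rtrancl_trans)

lemma sem_env_subset_states: "(\<And>X. \<rho> X \<subseteq> states L) \<Longrightarrow> sem_env L \<phi> \<rho> \<subseteq> states L"
proof (induction \<phi> arbitrary: \<rho>)
  case (MinFP X \<phi>)
  \<comment> \<open>\<open>states L\<close> is a pre-fixed point, hence one of the sets
    intersected.\<close>
  have "sem_env L \<phi> (\<rho>(X := states L)) \<subseteq> states L"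
    by (rule MinFP.IH) (use MinFP.prems in auto)
  then show ?case by auto
next
  case (MaxFP X \<phi>)
  show ?case by auto
next
  case (Or \<phi> \<psi>)
  from Or.IH[of \<rho>, OF Or.prems] show ?case by simp
next
  case (And \<phi> \<psi>)
  from And.IH(1)[of \<rho>, OF And.prems] show ?case by auto
qed auto

lemma sem_subset_states: "sem L \<phi> \<subseteq> states L"
  unfolding sem_def by (rule sem_env_subset_states) simp

lemma sem_env_mono: "(\<And>X. \<rho> X \<subseteq> \<rho>' X) \<Longrightarrow> sem_env L \<phi> \<rho> \<subseteq> sem_env L \<phi> \<rho>'"
proof (induction \<phi> arbitrary: \<rho> \<rho>')
  case (MinFP X \<phi>)
  have "sem_env L \<phi> (\<rho>(X := P)) \<subseteq> sem_env L \<phi> (\<rho>'(X := P))" for P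
    by (rule MinFP.IH) (use MinFP.prems in auto)
  \<comment> \<open>Pre-fixed points for the larger environment are also pre-fixed points for the
    smaller one.\<close>
  then show ?case unfolding sem_env.simps by (intro Inter_anti_mono) blast
next
  case (MaxFP X \<phi>)
  have "sem_env L \<phi> (\<rho>(X := P)) \<subseteq> sem_env L \<phi> (\<rho>'(X := P))" for P
    by (rule MaxFP.IH) (use MaxFP.prems in auto)
  then show ?case unfolding sem_env.simps by (intro Union_mono) blast
next
  case (Or \<phi> \<psi>)
  from Or.IH[of \<rho> \<rho>', OF Or.prems] show ?case by auto
next
  case (And \<phi> \<psi>)
  from And.IH[of \<rho> \<rho>', OF And.prems] show ?case by auto
next
  case (Dia \<alpha> \<phi>)
  from Dia.IH[of \<rho> \<rho>', OF Dia.prems] show ?case by auto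
next
  case (Box \<alpha> \<phi>)
  from Box.IH[of \<rho> \<rho>', OF Box.prems] show ?case by auto
qed auto

lemma sem_env_MinFP_least:
  "P \<subseteq> states L \<Longrightarrow> sem_env L \<phi> (\<rho>(X := P)) \<subseteq> P \<Longrightarrow> sem_env L (MinFP X \<phi>) \<rho> \<subseteq> P"
  by auto

text \<open>Knaster-Tarski. The bound on \<open>\<rho>\<close> keeps the unfolded body inside
  \<open>states L\<close>, where pre-fixed points are required to lie.\<close>

lemma sem_env_MinFP_unfold:
  assumes "\<And>X. \<rho> X \<subseteq> states L"
  shows "sem_env L (MinFP X \<phi>) \<rho> = sem_env L \<phi> (\<rho>(X := sem_env L (MinFP X \<phi>) \<rho>))"
    (is "?M = ?F ?M")
proof
  have mono: "?F P \<subseteq> ?F Q" if "P \<subseteq> Q" for P Q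
    by (rule sem_env_mono) (use that in simp)
  show pre: "?F ?M \<subseteq> ?M"
  proof
    fix s assume s: "s \<in> ?F ?M"
    have "s \<in> P" if "P \<subseteq> states L" "?F P \<subseteq> P" for P
      using mono[OF sem_env_MinFP_least[OF that]] that s by blast
    then show "s \<in> ?M" by (simp only: sem_env.simps) blast
  qed
  have "?M \<subseteq> states L" by (rule sem_env_subset_states) (rule assms)
  then have "?F ?M \<subseteq> states L" using pre by blast
  then show "?M \<subseteq> ?F ?M" by (rule sem_env_MinFP_least) (rule mono[OF pre])
qed

section \<open>From tests to formulae\<close>

primrec test_fm :: "'a test \<Rightarrow> 'a fm" where
  "test_fm TNil = FF"
| "test_fm (TPre \<alpha> t) = Dia \<alpha> (test_fm t)"
| "test_fm TOmega = TT"
| "test_fm (TVar X) = FVar X"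
| "test_fm (TSum t u) = Or (test_fm t) (test_fm u)"
| "test_fm (TMu X t) = MinFP X (test_fm t)"

lemma fv_test_fm [simp]: "fv (test_fm t) = test_fv t"
  by (induction t) auto

lemma test_fm_mayHML: "t \<in> tests Act \<Longrightarrow> test_fm t \<in> mayHML Act"
proof -
  have "may_fragment (test_fm t)" by (induction t) auto
  moreover have "fm_over Act (test_fm t) \<longleftrightarrow> test_over Act t" by (induction t) auto
  ultimately show "t \<in> tests Act \<Longrightarrow> test_fm t \<in> mayHML Act"
    by (simp add: tests_def mayHML_def)
qed

subsection \<open>Soundness\<close>

(* Like tsubst, this does not rename bound variables; it is applied to closed terms only, apart from
   the identity on variables that are bound further out. *)
primrec tsubsts :: "'a test \<Rightarrow> (nat \<Rightarrow> 'a test) \<Rightarrow> 'a test" where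
  "tsubsts TNil \<sigma> = TNil"
| "tsubsts (TPre \<alpha> t) \<sigma> = TPre \<alpha> (tsubsts t \<sigma>)"
| "tsubsts TOmega \<sigma> = TOmega"
| "tsubsts (TVar X) \<sigma> = \<sigma> X"
| "tsubsts (TSum t u) \<sigma> = TSum (tsubsts t \<sigma>) (tsubsts u \<sigma>)"
| "tsubsts (TMu X t) \<sigma> = TMu X (tsubsts t (\<sigma>(X := TVar X)))"

lemma tsubst_fresh: "X \<notin> test_fv t \<Longrightarrow> tsubst t X u = t"
  by (induction t) auto

lemma tsubsts_id: "(\<And>X. X \<in> test_fv t \<Longrightarrow> \<sigma> X = TVar X) \<Longrightarrow> tsubsts t \<sigma> = t"
  by (induction t arbitrary: \<sigma>) auto

text \<open>Relates the unfolding of a recursive test to an extended substitution; freshness keeps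
  \<open>tsubst\<close> from touching the terms already inserted.\<close>

lemma tsubst_tsubsts:
  assumes "\<And>Y. Y \<noteq> X \<Longrightarrow> X \<notin> test_fv (\<sigma> Y)"
  shows "tsubst (tsubsts t (\<sigma>(X := TVar X))) X u = tsubsts t (\<sigma>(X := u))"
  using assms
proof (induction t arbitrary: \<sigma>)
  case (TMu Y t)
  show ?case
  proof (cases "Y = X")
    case False
    have "tsubst (tsubsts t ((\<sigma>(Y := TVar Y))(X := TVar X))) X u
        = tsubsts t ((\<sigma>(Y := TVar Y))(X := u))"
      by (rule TMu.IH) (use TMu.prems False in auto)
    then show ?thesis using False by (simp add: fun_upd_twist del: fun_upd_apply)
  qed (simp del: fun_upd_apply)
qed (auto simp: tsubst_fresh)

text \<open>Only an inclusion, since a binder may capture variables of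
  \<open>\<sigma>\<close>.\<close>

lemma test_fv_tsubsts: "test_fv (tsubsts t \<sigma>) \<subseteq> (\<Union>X \<in> test_fv t. test_fv (\<sigma> X))"
proof (induction t arbitrary: \<sigma>)
  case (TMu X t)
  show ?case
  proof
    fix Y assume "Y \<in> test_fv (tsubsts (TMu X t) \<sigma>)"
    then obtain Z where "Z \<in> test_fv t" "Y \<in> test_fv ((\<sigma>(X := TVar X)) Z)" "Y \<noteq> X"
      using TMu.IH[of "\<sigma>(X := TVar X)"] by (auto simp del: fun_upd_apply)
    then show "Y \<in> (\<Union>Z \<in> test_fv (TMu X t). test_fv (\<sigma> Z))"
      by (cases "Z = X") auto
  qed
next
  case (TSum t u)
  from TSum.IH[of \<sigma>] show ?case by auto
qed auto

text \<open>Generalised to open tests for the induction: closed tests replace the free variables,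
  and the environment stays within their success sets.\<close>

lemma sem_env_test_fm_sound:
  assumes "\<And>X. test_fv (\<sigma> X) = {}"
    and "\<And>X. \<rho> X \<subseteq> {p \<in> states L. reaches_success L (p, \<sigma> X)}"
  shows "sem_env L (test_fm t) \<rho> \<subseteq> {p \<in> states L. reaches_success L (p, tsubsts t \<sigma>)}"
  using assms
proof (induction t arbitrary: \<sigma> \<rho>)
  case (TPre \<alpha> t)
  from TPre.IH[of \<sigma> \<rho>, OF TPre.prems] show ?case by (auto intro: reaches_success_prefix)
next
  case (TSum t u)
  have sum: "reaches_success L (p, TSum t u)"
    if "reaches_success L (p, t) \<or> reaches_success L (p, u)" for p t u
    using that by (auto elim!: reaches_success_simulate intro: test_step.sum1 test_step.sum2)
  from TSum.IH[of \<sigma> \<rho>, OF TSum.prems] show ?case by (auto intro: sum)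
next
  case (TOmega)
  show ?case by (auto intro: reaches_success_omega test_step.omega)
next
  case (TMu X t)
  define u where "u = TMu X (tsubsts t (\<sigma>(X := TVar X)))"
  define P where "P = {p \<in> states L. reaches_success L (p, u)}"
  have "test_fv (tsubsts t (\<sigma>(X := TVar X))) \<subseteq> {X}"
    using test_fv_tsubsts[of t "\<sigma>(X := TVar X)"] TMu.prems(1)
    by (fastforce split: if_splits)
  then have closed: "test_fv u = {}" unfolding u_def by auto
  \<comment> \<open>With \<open>X\<close> sent to \<open>u\<close>, the set \<open>P\<close> is
    exactly the bound required of the environment at \<open>X\<close>.\<close>
  have "sem_env L (test_fm t) (\<rho>(X := P))
      \<subseteq> {p \<in> states L. reaches_success L (p, tsubsts t (\<sigma>(X := u)))}"
    by (rule TMu.IH) (use TMu.prems closed in \<open>auto simp: P_def\<close>)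
  also have "tsubsts t (\<sigma>(X := u)) = tsubst (tsubsts t (\<sigma>(X := TVar X))) X u"
    by (rule tsubst_tsubsts[symmetric]) (simp add: TMu.prems(1))
  \<comment> \<open>The unfolded test is one \<open>Tau\<close> step away from
    \<open>u\<close>.\<close>
  also have "{p \<in> states L. reaches_success L (p, \<dots>)} \<subseteq> P"
    using test_step.mu unfolding P_def u_def
    by (fastforce intro: reaches_success_step exp_step.test)
  finally have "sem_env L (test_fm t) (\<rho>(X := P)) \<subseteq> P" .
  then have "sem_env L (test_fm (TMu X t)) \<rho> \<subseteq> P"
    unfolding test_fm.simps by (intro sem_env_MinFP_least) (simp_all add: P_def)
  then show ?case by (simp add: P_def u_def)
qed auto

lemma sem_test_fm_sound:
  assumes "test_fv t = {}" "p \<in> sem L (test_fm t)"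
  shows "reaches_success L (p, t)"
proof -
  \<comment> \<open>\<open>TNil\<close> is an arbitrary closed filler; the empty environment meets
    any bound.\<close>
  have "sem L (test_fm t) \<subseteq> {p \<in> states L. reaches_success L (p, tsubsts t (\<lambda>_. TNil))}"
    unfolding sem_def by (rule sem_env_test_fm_sound) auto
  moreover have "tsubsts t (\<lambda>_. TNil) = t" by (rule tsubsts_id) (simp add: assms(1))
  ultimately show ?thesis using assms(2) by auto
qed

subsection \<open>Completeness\<close>

lemma test_fv_tsubst: "test_fv (tsubst t X u) \<subseteq> (test_fv t - {X}) \<union> test_fv u"
  by (induction t) auto

lemma test_step_closed: "test_step t l t' \<Longrightarrow> test_fv t = {} \<Longrightarrow> test_fv t' = {}"
proof (induction rule: test_step.induct)
  case (mu X t)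
  then show ?case using test_fv_tsubst[of t X "TMu X t"] by auto
qed auto

text \<open>Substitution lemma: as \<open>u\<close> is closed, it has the same meaning under every
  binder and no variable is captured.\<close>

lemma sem_env_test_fm_tsubst:
  assumes "test_fv u = {}"
  shows "sem_env L (test_fm (tsubst t X u)) \<rho> = sem_env L (test_fm t) (\<rho>(X := sem L (test_fm u)))"
proof (induction t arbitrary: \<rho>)
  case (TVar Y)
  then show ?case using assms by (simp add: sem_closed)
next
  case (TMu Y t)
  then show ?case by (simp add: fun_upd_twist del: fun_upd_apply)
qed auto

lemma sem_test_fm_mu:
  assumes "test_fv (TMu X t) = {}"
  shows "sem L (test_fm (tsubst t X (TMu X t))) = sem L (test_fm (TMu X t))"
  unfolding sem_def sem_env_test_fm_tsubst[OF assms]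
  using sem_env_MinFP_unfold[of "\<lambda>_. {}" L X "test_fm t"] by (simp add: sem_def)

text \<open>Needed because the process in an experiment may move internally at any time while the
  test waits.\<close>

definition back_closed :: "('s, 'a) lts \<Rightarrow> 's set \<Rightarrow> bool" where
  "back_closed L P \<longleftrightarrow> (\<forall>s s'. (s, s') \<in> weak_tau L \<longrightarrow> s' \<in> P \<longrightarrow> s \<in> P)"

text \<open>Diamonds absorb leading internal moves, and unions preserve the property. A least fixed
  point is compared with its backward closed part.\<close>

lemma back_closed_sem_env_test_fm:
  assumes lts: "is_lts L"
    and "\<And>X. \<rho> X \<subseteq> states L" "\<And>X. back_closed L (\<rho> X)"
  shows "back_closed L (sem_env L (test_fm t) \<rho>)"
  using assms(2,3)
proof (induction t arbitrary: \<rho>)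
  case (TPre \<alpha> t)
  show ?case using weak_tau_states[OF lts] weak_tau_weak
    unfolding back_closed_def by fastforce
next
  case (TSum t u)
  from TSum.IH[of \<rho>, OF TSum.prems] show ?case unfolding back_closed_def by auto
next
  case TOmega
  show ?case using weak_tau_states[OF lts] unfolding back_closed_def by auto
next
  case (TMu X t)
  define M where "M = sem_env L (test_fm (TMu X t)) \<rho>"
  (* N is the largest backward closed subset of M, so it is a pre-fixed point as well. *)
  define N where "N = {s. \<forall>r. (r, s) \<in> weak_tau L \<longrightarrow> r \<in> M}"
  have "N \<subseteq> M" unfolding N_def weak_tau_def by auto
  have "M \<subseteq> states L" unfolding M_def by (rule sem_env_subset_states) (rule TMu.prems)
  with \<open>N \<subseteq> M\<close> have "N \<subseteq> states L" by blast
  have "back_closed L N"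
    unfolding back_closed_def N_def weak_tau_def by (auto dest: rtrancl_trans)
  \<comment> \<open>The induction hypothesis is applied at \<open>N\<close> because backward closure
    of \<open>M\<close> is still unknown.\<close>
  have "back_closed L (sem_env L (test_fm t) (\<rho>(X := N)))"
    by (rule TMu.IH) (use TMu.prems \<open>N \<subseteq> states L\<close> \<open>back_closed L N\<close> in auto)
  moreover have "sem_env L (test_fm t) (\<rho>(X := N)) \<subseteq> M"
  proof -
    have "sem_env L (test_fm t) (\<rho>(X := N)) \<subseteq> sem_env L (test_fm t) (\<rho>(X := M))"
      by (rule sem_env_mono) (use \<open>N \<subseteq> M\<close> in simp)
    also have "\<dots> = M"
      using sem_env_MinFP_unfold[of \<rho> L X "test_fm t"] TMu.prems(1) by (simp add: M_def)
    finally show ?thesis .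
  qed
  ultimately have "sem_env L (test_fm t) (\<rho>(X := N)) \<subseteq> N"
    unfolding back_closed_def N_def by blast
  with \<open>N \<subseteq> states L\<close> have "M \<subseteq> N"
    unfolding M_def test_fm.simps by (rule sem_env_MinFP_least)
  with \<open>N \<subseteq> M\<close> have "N = M" by blast
  with \<open>back_closed L N\<close> show ?case by (simp only: M_def)
qed (auto simp: back_closed_def)

lemma sem_test_fm_weak_tau:
  assumes "is_lts L" "(p, p') \<in> weak_tau L" "p' \<in> sem L (test_fm t)"
  shows "p \<in> sem L (test_fm t)"
  using back_closed_sem_env_test_fm[OF assms(1), of "\<lambda>_. {}" t] assms(2,3)
  unfolding sem_def back_closed_def by auto

text \<open>A prefix step is read off the diamond and a sum step off the union. Unfolding a
  recursion preserves the meaning, leaving only weak internal moves of the process.\<close>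

lemma sem_test_fm_test_step:
  assumes lts: "is_lts L" and "test_step t (Lab \<alpha>) t'" and "test_fv t = {}"
    and "weak L p \<alpha> p'" "p \<in> states L" "p' \<in> sem L (test_fm t')"
  shows "p \<in> sem L (test_fm t)"
  using assms(2-)
proof (induction t "Lab \<alpha>" t' rule: test_step.induct)
  case (mu X t)
  then have "(p, p') \<in> weak_tau L" "p' \<in> sem L (test_fm (TMu X t))"
    by (auto simp: sem_test_fm_mu simp del: test_fm.simps)
  then show ?case by (rule sem_test_fm_weak_tau[OF lts])
qed (auto simp: sem_def)

lemma sem_test_fm_omega:
  "test_step t l t' \<Longrightarrow> l = Omega \<Longrightarrow> p \<in> states L \<Longrightarrow> p \<in> sem L (test_fm t)"
  by (induction rule: test_step.induct) (auto simp: sem_def)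

lemma sem_test_fm_complete:
  assumes lts: "is_lts L" and "reaches_success L e" "test_fv (snd e) = {}" "fst e \<in> states L"
  shows "fst e \<in> sem L (test_fm (snd e))"
  using assms(2-)
proof (induction rule: reaches_success_induct)
  case (omega e t)
  then show ?case by (simp add: sem_test_fm_omega)
next
  case (step e e')
  from step.hyps(1) show ?case
  proof cases
    case (proc p p' t)
    then have "p' \<in> states L" using lts unfolding is_lts_def by blast
    then have "p' \<in> sem L (test_fm t)" using step proc by simp
    moreover have "(p, p') \<in> weak_tau L" using proc unfolding weak_tau_def by auto
    ultimately show ?thesis using sem_test_fm_weak_tau[OF lts] proc by simp
  next
    case (test t t' p)
    then have "p \<in> sem L (test_fm t')" using step test_step_closed by fastforce
    \<comment> \<open>The process stands still while the test moves, which is an empty weak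
      step.\<close>
    moreover have "weak L p Tau p" by (simp add: weak_tau_def)
    ultimately show ?thesis using sem_test_fm_test_step[OF lts] test step.prems by fastforce
  next
    case (sync p a p' t t')
    then have "p' \<in> states L" using lts unfolding is_lts_def by blast
    then have "p' \<in> sem L (test_fm t')" using step sync test_step_closed by fastforce
    moreover have "weak L p (Vis a) p'" using sync by (auto simp: weak_tau_def)
    ultimately show ?thesis using sem_test_fm_test_step[OF lts] sync step.prems by fastforce
  qed
qed

theorem corollary5p3:
  fixes L :: "('s, 'a) lts" and \<phi> :: "'a fm"
  assumes "is_lts L"
    and "\<phi> \<in> recHML (actions L)"
    and "may_testable L \<phi>"
  shows "\<exists>\<psi> \<in> mayHML (actions L). sem L \<psi> = sem L \<phi>"
proof -
  obtain t where t: "t \<in> tests (actions L)"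
    and test: "\<And>p. p \<in> states L \<Longrightarrow> may_satisfy L p t \<longleftrightarrow> p \<in> sem L \<phi>"
    using assms(3) unfolding may_testable_def by blast
  have closed: "test_fv t = {}" using t by (simp add: tests_def)
  have "p \<in> sem L (test_fm t) \<longleftrightarrow> may_satisfy L p t" if "p \<in> states L" for p
    using sem_test_fm_sound[OF closed] sem_test_fm_complete[OF assms(1), of "(p, t)"] closed that
    by (auto simp: may_satisfy_iff_reaches_success)
  then have "sem L (test_fm t) = sem L \<phi>"
    \<comment> \<open>Agreement on \<open>states L\<close> is equality, since both meanings lie
      inside it.\<close>
    using test sem_subset_states[of L] by blast
  with test_fm_mayHML[OF t] show ?thesis by blast
qed

end
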